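(* Let $G$ be a connected graph of order $n\geq 5$, size $m$ (number of edges), minimum degree $\delta$ and vertex-connectivity $\kappa$, and let $k$ be an integer with $\delta\geq k\geq 2$. (a) If $m \geq \frac12 n(n-1) - (\delta-k+2)(n-\delta-1)$, then $\kappa\geq k$, unless $G\cong K_{k-1}\vee (K_{\delta-k+2}\cup K_{n-\delta-1})$. (b) If $n\geq \frac12(k+1)(\delta-k+2)+(\delta+2)$ and $m \geq \frac12 n(n-1) - \frac12(\delta-k+2)(2n-2\delta+k-3)$, then $\kappa\geq k$, unless $G$ is isomorphic to a subgraph of $K_{k-1}\vee (K_{\delta-k+2}\cup K_{n-\delta-1})$.
   Context: All graphs are finite, simple and undirected. The vertex-connectivity $\kappa(G)$ of a connected non-complete graph is the minimum size of a vertex set whose removal disconnects $G$, and $\kappa(K_n)=n-1$. $K_r$ denotes the complete graph on $r$ vertices, $G_1\cup G_2$ denotes the disjoint union, and $G_1\vee G_2$ denotes the join, obtained from $G_1\cup G_2$ by joining every vertex of $G_1$ to every vertex of $G_2$. *)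

theory Defs
  imports Complex_Main "Graph_Theory.Graph_Theory"
begin

text \<open>
  Finite simple undirected graphs are represented as in \<^theory>\<open>Graph_Theory.Pair_Digraph\<close>, by
  the predicate \<^const>\<open>pair_graph\<close>: an undirected edge $uv$ is the pair of arcs $(u,v)$, $(v,u)$.
\<close>

definition edges :: "'a pair_pre_digraph \<Rightarrow> 'a set set" where
  "edges G = {{u, v} | u v. (u, v) \<in> parcs G}"

text \<open>
  On a graph, out-degree, in-degree and the number of neighbours coincide.
\<close>
definition min_degree :: "'a pair_pre_digraph \<Rightarrow> nat" where
  "min_degree G = (MIN v \<in> pverts G. out_degree (with_proj G) v)"

text \<open>
  The subset is required to be proper since the library's \<open>connected\<close> is false of the
  graph without vertices, which is not meant to count as disconnected here.
\<close>
definition disconnecting_sets :: "'a pair_pre_digraph \<Rightarrow> 'a set set" where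
  "disconnecting_sets G =
     {S. S \<subset> pverts G \<and> \<not> Digraph_Component.connected (with_proj G \<restriction> (pverts G - S))}"

text \<open>
  In a non-complete graph the minimum is over a nonempty finite set: deleting all vertices except
  two non-adjacent ones disconnects the graph.
\<close>
definition vertex_connectivity :: "'a pair_pre_digraph \<Rightarrow> nat" where
  "vertex_connectivity G =
     (if complete_digraph (card (pverts G)) (with_proj G) then card (pverts G) - 1
      else (MIN S \<in> disconnecting_sets G. card S))"

definition complete_graph :: "nat \<Rightarrow> nat pair_pre_digraph" where
  "complete_graph r = \<lparr> pverts = {..<r}, parcs = {(u, v). u < r \<and> v < r \<and> u \<noteq> v} \<rparr>"

definition disjoint_union ::
  "'a pair_pre_digraph \<Rightarrow> 'b pair_pre_digraph \<Rightarrow> ('a + 'b) pair_pre_digraph" where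
  "disjoint_union G H =
     \<lparr> pverts = Inl ` pverts G \<union> Inr ` pverts H,
       parcs = {(Inl u, Inl v) | u v. (u, v) \<in> parcs G} \<union> {(Inr u, Inr v) | u v. (u, v) \<in> parcs H} \<rparr>"

definition graph_join ::
  "'a pair_pre_digraph \<Rightarrow> 'b pair_pre_digraph \<Rightarrow> ('a + 'b) pair_pre_digraph" where
  "graph_join G H =
     \<lparr> pverts = pverts (disjoint_union G H),
       parcs = parcs (disjoint_union G H)
         \<union> Inl ` pverts G \<times> Inr ` pverts H \<union> Inr ` pverts H \<times> Inl ` pverts G \<rparr>"

definition isomorphic :: "'a pair_pre_digraph \<Rightarrow> 'b pair_pre_digraph \<Rightarrow> bool" where
  "isomorphic G H \<longleftrightarrow> digraph_iso (with_proj G) (with_proj H)"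

definition isomorphic_to_subgraph :: "'a pair_pre_digraph \<Rightarrow> 'b pair_pre_digraph \<Rightarrow> bool" where
  "isomorphic_to_subgraph G X \<longleftrightarrow>
     (\<exists>H. pair_graph H \<and> subgraph (with_proj H) (with_proj X) \<and> isomorphic G H)"

lemma complete_digraph_complete_graph: "complete_digraph r (with_proj (complete_graph r))"
  unfolding complete_digraph_pair_def by (auto simp: complete_graph_def)

lemma pair_graph_complete_graph: "pair_graph (complete_graph r)"
  using complete_digraph_complete_graph
  by (auto simp: complete_digraph_def intro: pair_graphI_graph)

lemma pair_graph_iff:
  "pair_graph G \<longleftrightarrow> finite (pverts G) \<and> parcs G \<subseteq> pverts G \<times> pverts G \<and> sym (parcs G) \<and> irrefl (parcs G)"
proof
  assume "pair_graph G"
  then interpret pair_graph G .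
  show "finite (pverts G) \<and> parcs G \<subseteq> pverts G \<times> pverts G \<and> sym (parcs G) \<and> irrefl (parcs G)"
    by (auto simp: irrefl_def pair_finite_verts
        intro: symI in_arcsD1 in_arcsD2 arcs_symmetric dest: no_loops')
next
  assume A: "finite (pverts G) \<and> parcs G \<subseteq> pverts G \<times> pverts G \<and> sym (parcs G) \<and> irrefl (parcs G)"
  then have "finite (parcs G)"
    by (meson finite_SigmaI finite_subset)
  with A show "pair_graph G"
    by unfold_locales (auto simp: symmetric_def irrefl_def)
qed

lemma pair_graph_disjoint_union:
  "pair_graph G \<Longrightarrow> pair_graph H \<Longrightarrow> pair_graph (disjoint_union G H)"
  by (auto simp: pair_graph_iff disjoint_union_def irrefl_def sym_def)

lemma pair_graph_graph_join:
  "pair_graph G \<Longrightarrow> pair_graph H \<Longrightarrow> pair_graph (graph_join G H)"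
  by (auto simp: pair_graph_iff graph_join_def disjoint_union_def irrefl_def sym_def)

end

theory Submission
  imports Defs
begin

text \<open>
  If \<open>\<kappa> < k\<close>, a minimum vertex cut splits the remaining vertices into parts of sizes \<open>a\<close> and \<open>b\<close>
  with no edge between them.  The neighbours of a vertex of a part lie in that part or in the cut,
  so \<open>a, b \<ge> \<delta> + 1 - \<kappa>\<close>, and at least \<open>a * b\<close> pairs of vertices are not adjacent.  The bound on
  \<open>m\<close> bounds \<open>a * b\<close> from above, which forces \<open>\<kappa> = k - 1\<close> and one part of the minimal size
  \<open>\<delta> - k + 2\<close>.  In (b) the bound still admits \<open>a, b \<ge> \<delta> - k + 3\<close>, but only with equality; then all
  pairs not separated by the cut are adjacent, and every degree exceeds \<open>\<delta>\<close>.
\<close>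

section \<open>Separations and vertex connectivity\<close>

text \<open>If \<open>u\<close> does not reach \<open>v\<close> inside \<open>W\<close>, the
  vertices reachable from \<open>u\<close> and the rest of \<open>W\<close> are the two sides;
  conversely, no walk inside \<open>W\<close> leaves \<open>A\<close>. For \<open>W = {}\<close> the
  equivalence would fail, because the graph without vertices is not
  \<open>connected\<close>.\<close>

lemma disconnected_induce_iff:
  assumes "sym (parcs G)" and "W \<noteq> {}"
  shows "\<not> Digraph_Component.connected (with_proj G \<restriction> W) \<longleftrightarrow>
    (\<exists>A B. A \<noteq> {} \<and> B \<noteq> {} \<and> A \<inter> B = {} \<and> A \<union> B = W \<and> (\<forall>a\<in>A. \<forall>b\<in>B. (a, b) \<notin> parcs G))"
    (is "\<not> ?C \<longleftrightarrow> ?P")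
proof -
  define R where "R = {(u, v) \<in> parcs G. u \<in> W \<and> v \<in> W}"
  have "sym R"
    using assms(1) by (auto simp: R_def sym_def)
  \<comment> \<open>\<open>connected\<close> is defined through the symmetric closure of the arcs,
    which adds nothing to a symmetric relation.\<close>
  then have "(arcs_ends (with_proj G \<restriction> W))\<^sup>s = R"
    by (auto simp: arcs_ends_conv symcl_def R_def image_iff sym_def split_beta)
  then have C: "?C \<longleftrightarrow> (\<forall>u\<in>W. \<forall>v\<in>W. (u, v) \<in> rtrancl_on W R)"
    using assms(2) by (simp add: connected_conv)
  show ?thesis
  proof
    assume "\<not> ?C"
    then obtain u v where uv: "u \<in> W" "v \<in> W" "(u, v) \<notin> rtrancl_on W R"
      using C by auto
    define A where "A = {w \<in> W. (u, w) \<in> rtrancl_on W R}"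
    have "(a, b) \<notin> parcs G" if "a \<in> A" "b \<in> W - A" for a b
      using that by (auto simp: A_def R_def intro: rtrancl_on_into_rtrancl_on)
    moreover have "u \<in> A" "v \<in> W - A" "A \<subseteq> W"
      using uv by (auto simp: A_def)
    ultimately show ?P
      by (intro exI[of _ A] exI[of _ "W - A"]) auto
  next
    assume ?P
    then obtain A B where AB: "A \<noteq> {}" "B \<noteq> {}" "A \<inter> B = {}" "A \<union> B = W"
      and no: "\<forall>a\<in>A. \<forall>b\<in>B. (a, b) \<notin> parcs G"
      by blast
    then obtain a b where ab: "a \<in> A" "b \<in> B"
      by blast
    have "w \<in> A" if "(a, w) \<in> rtrancl_on W R" for w
      using that
    proof (induction rule: rtrancl_on_induct)
      case (step x y)
      then show ?case using AB no by (auto simp: R_def)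
    qed (rule ab)
    then show "\<not> ?C"
      using C ab AB by blast
  qed
qed

text \<open>Each side may be a union of several components of the graph left after deleting
  \<open>S\<close>, and \<open>S\<close> may be empty or larger than a minimum cut.\<close>

definition separation :: "'a pair_pre_digraph \<Rightarrow> 'a set \<Rightarrow> 'a set \<Rightarrow> 'a set \<Rightarrow> bool" where
  "separation G S A B \<longleftrightarrow>
     S \<union> A \<union> B = pverts G \<and> S \<inter> A = {} \<and> S \<inter> B = {} \<and> A \<inter> B = {} \<and> A \<noteq> {} \<and> B \<noteq> {} \<and>
     (\<forall>a\<in>A. \<forall>b\<in>B. (a, b) \<notin> parcs G)"

lemma separation_swap:
  "pair_graph G \<Longrightarrow> separation G S A B \<Longrightarrow> separation G S B A"
  unfolding separation_def pair_graph_iff sym_def by blast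

lemma separation_card:
  assumes "pair_graph G" and "separation G S A B"
  shows "card (pverts G) = card S + card A + card B"
    and "finite S" and "finite A" and "finite B"
proof -
  have U: "pverts G = S \<union> A \<union> B" and "finite (pverts G)"
    using assms by (auto simp: separation_def pair_graph_iff)
  then show "finite S" "finite A" "finite B"
    by auto
  moreover have "(S \<union> A) \<inter> B = {}" "S \<inter> A = {}"
    using assms(2) by (auto simp: separation_def)
  ultimately show "card (pverts G) = card S + card A + card B"
    by (simp add: U card_Un_disjoint)
qed

text \<open>A non-complete graph has non-adjacent vertices \<open>u\<close>, \<open>v\<close>, and
  deleting all others disconnects it. Hence the minimum ranges over a nonempty finite set and is
  attained by some cut.\<close>

lemma vertex_connectivity_separation:
  assumes "pair_graph G" and "\<not> complete_digraph (card (pverts G)) (with_proj G)"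
  obtains S A B where "separation G S A B" and "card S = vertex_connectivity G"
proof -
  have fin: "finite (pverts G)" and sub: "parcs G \<subseteq> pverts G \<times> pverts G"
    and sym: "sym (parcs G)" and irr: "irrefl (parcs G)"
    using assms(1) by (auto simp: pair_graph_iff)
  let ?D = "disconnecting_sets G"
  have "\<not> {(u, v). (u, v) \<in> pverts G \<times> pverts G \<and> u \<noteq> v} \<subseteq> parcs G"
    using assms(2) fin sub irr unfolding complete_digraph_pair_def irrefl_def by auto
  then obtain u v where uv: "u \<in> pverts G" "v \<in> pverts G" "u \<noteq> v" "(u, v) \<notin> parcs G"
    by auto
  have "\<not> Digraph_Component.connected (with_proj G \<restriction> {u, v})"
    using uv disconnected_induce_iff[OF sym, of "{u, v}"]
    by (metis disjoint_insert(1) empty_iff inf_bot_right insert_is_Un insert_not_empty singletonD)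
  moreover have "pverts G - (pverts G - {u, v}) = {u, v}"
    using uv by auto
  ultimately have "pverts G - {u, v} \<in> ?D"
    using uv by (auto simp: disconnecting_sets_def)
  moreover have "finite ?D"
    using fin by (auto simp: disconnecting_sets_def intro: finite_subset[of _ "Pow (pverts G)"])
  ultimately have "Min (card ` ?D) \<in> card ` ?D"
    by (intro Min_in) auto
  then have "vertex_connectivity G \<in> card ` ?D"
    using assms(2) by (simp add: vertex_connectivity_def)
  then obtain S where S: "card S = vertex_connectivity G" "S \<subset> pverts G"
    "\<not> Digraph_Component.connected (with_proj G \<restriction> (pverts G - S))"
    unfolding disconnecting_sets_def by (metis (mono_tags, lifting) imageE mem_Collect_eq)
  then have "pverts G - S \<noteq> {}"
    by blast
  then obtain A B where "A \<noteq> {}" "B \<noteq> {}" "A \<inter> B = {}" "A \<union> B = pverts G - S"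
    "\<forall>a\<in>A. \<forall>b\<in>B. (a, b) \<notin> parcs G"
    using disconnected_induce_iff[OF sym] S(3) by metis
  then have "separation G S A B"
    using S(2) unfolding separation_def by blast
  with S(1) that show ?thesis
    by blast
qed

section \<open>Degrees and the sides of a separation\<close>

lemma out_degree_conv_neighbours:
  "out_degree (with_proj G) v = card {w. (v, w) \<in> parcs G}"
proof -
  have "out_arcs (with_proj G) v = Pair v ` {w. (v, w) \<in> parcs G}"
    by (auto simp: out_arcs_def)
  then show ?thesis
    unfolding out_degree_def by (metis card_image inj_onI prod.inject)
qed

text \<open>All neighbours of a vertex \<open>a\<close> of \<open>A\<close> lie in
  \<open>(A - {a}) \<union> S\<close>; the omission of \<open>a\<close> makes the inequality
  strict.\<close>

lemma separation_min_degree_less: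
  assumes G: "pair_graph G" and sep: "separation G S A B"
  shows "min_degree G < card A + card S"
proof -
  note fin = separation_card[OF assms]
  obtain a where a: "a \<in> A"
    using sep by (auto simp: separation_def)
  have "{w. (a, w) \<in> parcs G} \<subseteq> (A - {a}) \<union> S"
  proof
    fix w
    assume w: "w \<in> {w. (a, w) \<in> parcs G}"
    then have "w \<in> pverts G" "w \<noteq> a"
      using G by (auto simp: pair_graph_iff irrefl_def)
    moreover have "w \<notin> B"
      using w a sep by (auto simp: separation_def)
    ultimately show "w \<in> (A - {a}) \<union> S"
      using sep unfolding separation_def by blast
  qed
  then have "card {w. (a, w) \<in> parcs G} \<le> card ((A - {a}) \<union> S)"
    using fin by (intro card_mono) auto
  also have "\<dots> \<le> card (A - {a}) + card S"
    by (rule card_Un_le)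
  also have "\<dots> < card A + card S"
    using a fin by (meson add_less_mono1 card_Diff1_less)
  finally have "out_degree (with_proj G) a < card A + card S"
    by (simp add: out_degree_conv_neighbours)
  moreover have "min_degree G \<le> out_degree (with_proj G) a"
    unfolding min_degree_def using G sep a
    by (intro Min_le) (auto simp: pair_graph_iff separation_def)
  ultimately show ?thesis
    by simp
qed

text \<open>This serves to exclude complete graphs, where minimum degree and connectivity
  coincide.\<close>

lemma min_degree_complete:
  assumes "complete_digraph (card (pverts G)) (with_proj G)" and "pverts G \<noteq> {}"
  shows "min_degree G = card (pverts G) - 1"
proof -
  have "{w. (v, w) \<in> parcs G} = pverts G - {v}" if "v \<in> pverts G" for v
    using assms(1) that by (auto simp: complete_digraph_pair_def)
  then have "(\<lambda>v. out_degree (with_proj G) v) ` pverts G = {card (pverts G) - 1}"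
    using assms by (auto simp: out_degree_conv_neighbours image_iff)
  then show ?thesis
    by (simp add: min_degree_def)
qed

section \<open>Saturation and the number of edges\<close>

text \<open>The extremal case of a separation: \<open>separation\<close> forbids the arcs between
  the sides, and saturation supplies all others.\<close>

definition saturated :: "'a pair_pre_digraph \<Rightarrow> 'a set \<Rightarrow> 'a set \<Rightarrow> bool" where
  "saturated G A B \<longleftrightarrow>
     (\<forall>u\<in>pverts G. \<forall>v\<in>pverts G. u \<noteq> v \<and> (u, v) \<notin> A \<times> B \<union> B \<times> A \<longrightarrow> (u, v) \<in> parcs G)"

lemma saturated_swap: "saturated G A B \<Longrightarrow> saturated G B A"
  by (auto simp: saturated_def)

text \<open>Saturation makes \<open>S \<union> A\<close> a clique; the \<open>+ 1\<close> counts
  \<open>v\<close> itself.\<close>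

lemma saturated_out_degree:
  assumes G: "pair_graph G" and sep: "separation G S A B" and sat: "saturated G A B"
    and v: "v \<in> S \<union> A"
  shows "card A + card S \<le> out_degree (with_proj G) v + 1"
proof -
  note fin = separation_card[OF assms(1,2)]
  have "S \<union> A - {v} \<subseteq> {w. (v, w) \<in> parcs G}"
  proof
    fix w
    assume w: "w \<in> S \<union> A - {v}"
    have "S \<union> A \<subseteq> pverts G" "(S \<union> A) \<inter> B = {}"
      using sep by (auto simp: separation_def)
    then have "v \<in> pverts G" "w \<in> pverts G" "v \<noteq> w" "(v, w) \<notin> A \<times> B \<union> B \<times> A"
      using v w by auto
    then show "w \<in> {w. (v, w) \<in> parcs G}"
      using sat unfolding saturated_def by blast
  qed
  moreover have "finite {w. (v, w) \<in> parcs G}"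
    using G by (auto simp: pair_graph_iff intro: finite_subset[of _ "pverts G"])
  ultimately have "card (S \<union> A - {v}) \<le> out_degree (with_proj G) v"
    by (simp add: out_degree_conv_neighbours card_mono)
  moreover have "card (S \<union> A) = card S + card A"
    using sep fin by (intro card_Un_disjoint) (auto simp: separation_def)
  ultimately show ?thesis
    using v fin by simp
qed

text \<open>A vertex of minimum degree lies in one of the cliques \<open>S \<union> A\<close> and
  \<open>S \<union> B\<close>. Together with \<open>separation_min_degree_less\<close> this fixes
  the size of the smaller side.\<close>

lemma saturated_min_degree:
  assumes G: "pair_graph G" and sep: "separation G S A B" and sat: "saturated G A B"
  shows "min (card A) (card B) + card S \<le> min_degree G + 1"
proof -
  have "pverts G \<noteq> {}" "finite (pverts G)"
    using G sep by (auto simp: separation_def pair_graph_iff)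
  then have "min_degree G \<in> out_degree (with_proj G) ` pverts G"
    unfolding min_degree_def by (intro Min_in) auto
  then obtain v where v: "v \<in> pverts G" "min_degree G = out_degree (with_proj G) v"
    by blast
  then consider "v \<in> S \<union> A" | "v \<in> S \<union> B"
    using sep by (auto simp: separation_def)
  then show ?thesis
    using saturated_out_degree[OF G sep sat]
      saturated_out_degree[OF G separation_swap[OF G sep] saturated_swap[OF sat]] v(2)
    by cases fastforce+
qed

text \<open>The edges and the \<open>card A * card B\<close> pairs across the cut are disjoint
  families of two-element vertex sets. In case of equality they exhaust all such sets, so every pair
  not across the cut is an edge.\<close>

lemma separation_edges:
  assumes G: "pair_graph G" and sep: "separation G S A B"
  shows "card (edges G) + card A * card B \<le> card (pverts G) choose 2"
    and "card (edges G) + card A * card B = card (pverts G) choose 2 \<Longrightarrow> saturated G A B"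
proof -
  note fin = separation_card[OF assms]
  define P where "P = {e. e \<subseteq> pverts G \<and> card e = 2}"
  define M where "M = (\<lambda>(a, b). {a, b}) ` (A \<times> B)"
  have finV: "finite (pverts G)"
    using G by (simp add: pair_graph_iff)
  have arc: "(u, v) \<in> parcs G" if "{u, v} \<in> edges G" for u v
    using that G by (auto simp: edges_def doubleton_eq_iff pair_graph_iff sym_def)
  have finP: "finite P"
    using finV by (auto simp: P_def intro: finite_subset[of _ "Pow (pverts G)"])
  have E: "edges G \<subseteq> P"
  proof
    fix e
    assume "e \<in> edges G"
    then obtain u v where e: "e = {u, v}" "(u, v) \<in> parcs G"
      by (auto simp: edges_def)
    moreover from this have "u \<noteq> v" "u \<in> pverts G" "v \<in> pverts G"
      using G by (auto simp: pair_graph_iff irrefl_def)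
    ultimately show "e \<in> P"
      by (simp add: P_def)
  qed
  have disj: "A \<inter> B = {}"
    using sep by (simp add: separation_def)
  have M: "M \<subseteq> P"
    using sep disj by (auto simp: M_def P_def separation_def card_insert_if)
  have EM: "edges G \<inter> M = {}"
    using sep by (auto simp: M_def separation_def dest!: arc)
  \<comment> \<open>As the sides are disjoint, \<open>{a, b}\<close> determines which of its
    elements comes from \<open>A\<close>.\<close>
  have "inj_on (\<lambda>(a, b). {a, b}) (A \<times> B)"
    using disj by (auto simp: inj_on_def doubleton_eq_iff)
  then have "card M = card A * card B"
    by (simp add: M_def card_image card_cartesian_product)
  moreover have "card (edges G \<union> M) = card (edges G) + card M"
    using E M EM finP by (meson card_Un_disjoint finite_subset)
  moreover have P: "card P = card (pverts G) choose 2"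
    using n_subsets[OF finV] by (simp add: P_def)
  ultimately have *: "card (edges G \<union> M) = card (edges G) + card A * card B"
    by simp
  have EMP: "edges G \<union> M \<subseteq> P"
    using E M by simp
  show "card (edges G) + card A * card B \<le> card (pverts G) choose 2"
    using card_mono[OF finP EMP] * P by simp
  assume "card (edges G) + card A * card B = card (pverts G) choose 2"
  then have eq: "edges G \<union> M = P"
    using card_subset_eq[OF finP EMP] * P by simp
  show "saturated G A B"
    unfolding saturated_def
  proof (intro ballI impI)
    fix u v
    assume "u \<in> pverts G" "v \<in> pverts G" and uv: "u \<noteq> v \<and> (u, v) \<notin> A \<times> B \<union> B \<times> A"
    then have "{u, v} \<in> P"
      using uv by (simp add: P_def)
    moreover have "{u, v} \<notin> M"
      using uv by (auto simp: M_def doubleton_eq_iff)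
    ultimately show "(u, v) \<in> parcs G"
      using eq arc by blast
  qed
qed

section \<open>Isomorphisms and the join of cliques\<close>

lemma isomorphic_image:
  assumes "pair_graph G" and "inj_on f (pverts G)"
  shows "isomorphic G \<lparr> pverts = f ` pverts G, parcs = map_prod f f ` parcs G \<rparr>"
proof -
  interpret pair_graph G by fact
  \<comment> \<open>An isomorphism of digraphs also carries an arc map and the head and tail
    functions of the target; since arcs are pairs, these are \<open>map_prod f f\<close> and the
    projections.\<close>
  let ?f = "\<lparr> iso_verts = f, iso_arcs = map_prod f f, iso_head = snd, iso_tail = fst \<rparr>"
  have "inj_on (map_prod f f) (parcs G)"
    using map_prod_inj_on[OF assms(2,2)] assms(1)
    by (auto simp: pair_graph_iff intro: inj_on_subset)
  then have "pre_digraph.digraph_isomorphism (with_proj G) ?f"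
    using assms(2) wf_digraph_axioms by (auto simp: digraph_isomorphism_def)
  then show ?thesis
    unfolding isomorphic_def digraph_iso_def
    by (intro exI[of _ ?f]) (auto simp: app_iso_def with_proj_def)
qed

text \<open>As adjacency is preserved and reflected, \<open>X\<close> equals the image of
  \<open>G\<close> under \<open>f\<close> as a record.\<close>

lemma isomorphicI:
  assumes G: "pair_graph G" and X: "pair_graph X" and f: "bij_betw f (pverts G) (pverts X)"
    and arcs: "\<And>u v. u \<in> pverts G \<Longrightarrow> v \<in> pverts G \<Longrightarrow> (u, v) \<in> parcs G \<longleftrightarrow> (f u, f v) \<in> parcs X"
  shows "isomorphic G X"
proof -
  have V: "f ` pverts G = pverts X"
    using f by (simp add: bij_betw_def)
  have "map_prod f f ` parcs G = parcs X"
  proof (intro equalityI subrelI)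
    fix x y assume xy: "(x, y) \<in> parcs X"
    then have "x \<in> f ` pverts G" "y \<in> f ` pverts G"
      using X V by (auto simp: pair_graph_iff)
    with xy show "(x, y) \<in> map_prod f f ` parcs G"
      using arcs by force
  qed (use G arcs in \<open>auto simp: pair_graph_iff\<close>)
  then have "X = \<lparr> pverts = f ` pverts G, parcs = map_prod f f ` parcs G \<rparr>"
    using V by (intro pair_pre_digraph.equality) auto
  then show ?thesis
    using isomorphic_image[OF G] f by (metis bij_betw_def)
qed

text \<open>The witness is the image of \<open>G\<close> under \<open>f\<close>, a spanning subgraph
  of \<open>X\<close> that inherits the absence of loops from \<open>X\<close>.\<close>

lemma isomorphic_to_subgraphI:
  assumes G: "pair_graph G" and X: "pair_graph X" and f: "bij_betw f (pverts G) (pverts X)"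
    and arcs: "\<And>u v. (u, v) \<in> parcs G \<Longrightarrow> (f u, f v) \<in> parcs X"
  shows "isomorphic_to_subgraph G X"
proof -
  let ?H = "\<lparr> pverts = f ` pverts G, parcs = map_prod f f ` parcs G \<rparr>"
  have inj: "inj_on f (pverts G)" and V: "f ` pverts G = pverts X"
    using f by (auto simp: bij_betw_def)
  have sub: "parcs ?H \<subseteq> parcs X"
    using arcs by auto
  have "sym (parcs ?H)"
    using G by (force simp: pair_graph_iff sym_def)
  then have H: "pair_graph ?H"
    using G X V sub by (auto simp: pair_graph_iff irrefl_def)
  interpret H: pair_graph ?H by (rule H)
  interpret X: pair_graph X by (rule X)
  have "subgraph (with_proj ?H) (with_proj X)"
    unfolding subgraph_def
    using V sub H.wf_digraph_axioms X.wf_digraph_axioms by auto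
  then show ?thesis
    unfolding isomorphic_to_subgraph_def using H isomorphic_image[OF G inj] by blast
qed

text \<open>For positive \<open>a\<close> and \<open>b\<close>, this is the edge-maximal graph with
  a cut of \<open>s\<close> vertices and sides of \<open>a\<close> and \<open>b\<close>
  vertices.\<close>

abbreviation (input) join_of_cliques :: "nat \<Rightarrow> nat \<Rightarrow> nat \<Rightarrow> (nat + (nat + nat)) pair_pre_digraph" where
  "join_of_cliques s a b \<equiv>
     graph_join (complete_graph s) (disjoint_union (complete_graph a) (complete_graph b))"

lemma pair_graph_join_of_cliques: "pair_graph (join_of_cliques s a b)"
  by (intro pair_graph_graph_join pair_graph_disjoint_union pair_graph_complete_graph)

text \<open>\<open>S\<close>, \<open>A\<close> and \<open>B\<close> are numbered separately and sent
  to the three cliques. The resulting equivalence does not mention the arcs of \<open>G\<close>, so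
  it serves both the embedding as a subgraph and the isomorphism in the saturated case.\<close>

lemma separation_bij_join_of_cliques:
  assumes G: "pair_graph G" and sep: "separation G S A B"
  obtains f where "bij_betw f (pverts G) (pverts (join_of_cliques (card S) (card A) (card B)))"
    and "\<And>u v. u \<in> pverts G \<Longrightarrow> v \<in> pverts G \<Longrightarrow>
      (f u, f v) \<in> parcs (join_of_cliques (card S) (card A) (card B)) \<longleftrightarrow>
      u \<noteq> v \<and> (u, v) \<notin> A \<times> B \<union> B \<times> A"
proof -
  note fin = separation_card[OF assms]
  have V: "pverts G = S \<union> (A \<union> B)" and disj: "S \<inter> (A \<union> B) = {}" "A \<inter> B = {}"
    using sep by (auto simp: separation_def)
  obtain g h i where g: "bij_betw g S {..<card S}" and h: "bij_betw h A {..<card A}"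
    and i: "bij_betw i B {..<card B}"
    using fin(2-4) ex_bij_betw_finite_nat by (metis atLeast0LessThan)
  define f where "f v = (if v \<in> S then Inl (g v) else
    if v \<in> A then Inr (Inl (h v)) else Inr (Inr (i v)))" for v
  have fS: "f v = Inl (g v)" if "v \<in> S" for v
    using that by (simp add: f_def)
  have fA: "f v = Inr (Inl (h v))" if "v \<in> A" for v
    using that disj by (auto simp: f_def)
  have fB: "f v = Inr (Inr (i v))" if "v \<in> B" for v
    using that disj by (auto simp: f_def)
  have inj: "inj_on g S" "inj_on h A" "inj_on i B"
    and im: "g ` S = {..<card S}" "h ` A = {..<card A}" "i ` B = {..<card B}"
    using g h i by (auto simp: bij_betw_def)
  have mem: "v \<in> S \<Longrightarrow> g v < card S" "v \<in> A \<Longrightarrow> h v < card A" "v \<in> B \<Longrightarrow> i v < card B" for v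
    using im by blast+
  have notin: "v \<in> S \<Longrightarrow> v \<notin> A \<and> v \<notin> B" "v \<in> A \<Longrightarrow> v \<notin> B" for v
    using disj by auto
  have "f ` pverts G = Inl ` g ` S \<union> Inr ` (Inl ` h ` A \<union> Inr ` i ` B)"
    unfolding V by (simp add: image_Un image_image fS fA fB cong: image_cong)
  then have "f ` pverts G = pverts (join_of_cliques (card S) (card A) (card B))"
    unfolding im by (simp add: graph_join_def disjoint_union_def complete_graph_def)
  moreover have "inj_on f (pverts G)"
    unfolding V
    by (intro inj_onI) (auto simp: fS fA fB dest: inj[THEN inj_onD])
  ultimately have bij: "bij_betw f (pverts G) (pverts (join_of_cliques (card S) (card A) (card B)))"
    by (simp add: bij_betw_def)
  have "(f u, f v) \<in> parcs (join_of_cliques (card S) (card A) (card B)) \<longleftrightarrow>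
      u \<noteq> v \<and> (u, v) \<notin> A \<times> B \<union> B \<times> A" if "u \<in> pverts G" "v \<in> pverts G" for u v
    using that notin mem unfolding V
    by (elim UnE) (auto simp: fS fA fB graph_join_def disjoint_union_def complete_graph_def
        inj[THEN inj_on_eq_iff])
  with bij show thesis
    by (rule that)
qed

lemma separation_isomorphic_to_subgraph:
  assumes G: "pair_graph G" and sep: "separation G S A B"
  shows "isomorphic_to_subgraph G (join_of_cliques (card S) (card A) (card B))"
proof -
  obtain f where f: "bij_betw f (pverts G) (pverts (join_of_cliques (card S) (card A) (card B)))"
    "\<And>u v. u \<in> pverts G \<Longrightarrow> v \<in> pverts G \<Longrightarrow>
      (f u, f v) \<in> parcs (join_of_cliques (card S) (card A) (card B)) \<longleftrightarrow>
      u \<noteq> v \<and> (u, v) \<notin> A \<times> B \<union> B \<times> A"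
    using separation_bij_join_of_cliques[OF assms] by metis
  show ?thesis
  proof (rule isomorphic_to_subgraphI[OF G pair_graph_join_of_cliques f(1)])
    fix u v assume "(u, v) \<in> parcs G"
    moreover from this have "u \<in> pverts G" "v \<in> pverts G" "u \<noteq> v" "(v, u) \<in> parcs G"
      using G by (auto simp: pair_graph_iff irrefl_def sym_def)
    ultimately show "(f u, f v) \<in> parcs (join_of_cliques (card S) (card A) (card B))"
      using f(2) sep by (auto simp: separation_def)
  qed
qed

lemma saturated_isomorphic:
  assumes G: "pair_graph G" and sep: "separation G S A B" and sat: "saturated G A B"
  shows "isomorphic G (join_of_cliques (card S) (card A) (card B))"
proof -
  obtain f where f: "bij_betw f (pverts G) (pverts (join_of_cliques (card S) (card A) (card B)))"
    "\<And>u v. u \<in> pverts G \<Longrightarrow> v \<in> pverts G \<Longrightarrow>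
      (f u, f v) \<in> parcs (join_of_cliques (card S) (card A) (card B)) \<longleftrightarrow>
      u \<noteq> v \<and> (u, v) \<notin> A \<times> B \<union> B \<times> A"
    using separation_bij_join_of_cliques[OF G sep] by metis
  have "(u, v) \<in> parcs G \<longleftrightarrow> u \<noteq> v \<and> (u, v) \<notin> A \<times> B \<union> B \<times> A"
    if "u \<in> pverts G" "v \<in> pverts G" for u v
  proof
    assume "(u, v) \<in> parcs G"
    moreover from this have "u \<noteq> v" "(v, u) \<in> parcs G"
      using G by (auto simp: pair_graph_iff irrefl_def sym_def)
    ultimately show "u \<noteq> v \<and> (u, v) \<notin> A \<times> B \<union> B \<times> A"
      using sep by (auto simp: separation_def)
  qed (use sat that in \<open>auto simp: saturated_def\<close>)
  then show ?thesis
    using isomorphicI[OF G pair_graph_join_of_cliques f(1)] f(2) by blast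
qed

section \<open>Arithmetic of the side sizes\<close>

text \<open>
  In the next two lemmas \<open>q\<close> is the least possible size \<open>\<delta> + 1 - \<kappa>\<close> of a part of the separation,
  \<open>p\<close> stands for \<open>\<delta> - k + 2\<close> and \<open>N\<close> for \<open>n - \<delta> - 1\<close>.  Both rest on
  \<open>a * b = q * (a + b - q) + (a - q) * (b - q)\<close>.
\<close>

lemma part_sizes_few_missing:
  fixes a b p q N :: real
  assumes "a \<ge> q" "b \<ge> q" "q \<ge> p" "N > 0" "a + b = q + N" and le: "a * b \<le> p * N"
  shows "q = p" and "a = p \<or> b = p" and "a * b = p * N"
proof -
  have "a * b = q * N + (a - q) * (b - q)"
    using assms(5) by (simp add: algebra_simps) algebra
  moreover have nn: "0 \<le> (a - q) * (b - q)"
    using assms by simp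
  moreover have "p * N \<le> q * N"
    using assms by simp
  \<comment> \<open>The chain \<open>p * N \<le> q * N \<le> a * b \<le> p * N\<close> collapses to
    equalities.\<close>
  ultimately have "q * N = p * N" "(a - q) * (b - q) = 0" "a * b = p * N"
    using le by linarith+
  then show "q = p" "a = p \<or> b = p" "a * b = p * N"
    using assms(4) by auto
qed

lemma part_sizes_more_missing:
  fixes a b p q N k :: real
  assumes "a \<ge> q" "b \<ge> q" "q = p \<or> q \<ge> p + 1" "p \<ge> 0" "k \<ge> 0" "a + b = q + N"
    and N: "2 * (N - 1) \<ge> (k + 1) * p" and le: "2 * (a * b) \<le> p * (2 * N + k - 1)"
  shows "q = p" and "a \<ge> p + 1 \<Longrightarrow> b \<ge> p + 1 \<Longrightarrow> 2 * (a * b) = p * (2 * N + k - 1)"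
proof -
  show q: "q = p"
  proof (rule ccontr)
    assume "q \<noteq> p"
    then have "q \<ge> p + 1"
      using assms by auto
    have "0 \<le> (k + 1) * p"
      using assms by simp
    then have "0 \<le> 2 * (N - 1)"
      using N by (rule order_trans)
    then have "0 \<le> N"
      by simp
    then have "(p + 1) * N \<le> q * N"
      using \<open>q \<ge> p + 1\<close> by (rule mult_right_mono[rotated])
    moreover have "a * b = q * N + (a - q) * (b - q)"
      using assms(6) by (simp add: algebra_simps) algebra
    moreover have "0 \<le> (a - q) * (b - q)"
      using assms by simp
    ultimately have "2 * ((p + 1) * N) \<le> p * (2 * N + k - 1)"
      using le by linarith
    \<comment> \<open>The last inequality says \<open>2 * N \<le> p * (k - 1)\<close>, whereas the
      hypothesis on \<open>N\<close> gives \<open>2 * N \<ge> p * (k + 1) + 2\<close>.\<close>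
    then show False
      using N assms(4) by (simp add: algebra_simps)
  qed
  assume "a \<ge> p + 1" "b \<ge> p + 1"
  then have "0 \<le> (a - (p + 1)) * (b - (p + 1))"
    by simp
  \<comment> \<open>The same identity with \<open>p + 1\<close> in place of \<open>q\<close>, using
    \<open>a + b = p + N\<close>.\<close>
  moreover have "a * b = (p + 1) * (N - 1) + (a - (p + 1)) * (b - (p + 1))"
    using assms(6) q by (simp add: algebra_simps) algebra
  ultimately have "(p + 1) * (N - 1) \<le> a * b"
    by linarith
  \<comment> \<open>The hypothesis on \<open>N\<close> is equivalent to
    \<open>p * (2 * N + k - 1) \<le> 2 * ((p + 1) * (N - 1))\<close>.\<close>
  then have "p * (2 * N + k - 1) \<le> 2 * (a * b)"
    using N by (simp add: algebra_simps)
  then show "2 * (a * b) = p * (2 * N + k - 1)"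
    using le by simp
qed

section \<open>From the bounds on the number of edges to the exceptional graph\<close>

theorem theorem2p1:
  fixes G :: "'a pair_pre_digraph" and n m \<delta> \<kappa> k :: nat
  assumes "pair_graph G"
    and "Digraph_Component.connected (with_proj G)"
    and "n = card (pverts G)" and "n \<ge> 5"
    and "m = card (edges G)"
    and "\<delta> = min_degree G"
    and "\<kappa> = vertex_connectivity G"
    and "\<delta> \<ge> k" and "k \<ge> 2"
  shows "(real m \<ge> 1 / 2 * real n * (real n - 1)
              - (real \<delta> - real k + 2) * (real n - real \<delta> - 1)
            \<longrightarrow> \<kappa> \<ge> k
              \<or> isomorphic G (graph_join (complete_graph (k - 1))
                  (disjoint_union (complete_graph (\<delta> - k + 2)) (complete_graph (n - \<delta> - 1)))))
       \<and> (real n \<ge> 1 / 2 * (real k + 1) * (real \<delta> - real k + 2) + (real \<delta> + 2)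
            \<and> real m \<ge> 1 / 2 * real n * (real n - 1)
              - 1 / 2 * (real \<delta> - real k + 2) * (2 * real n - 2 * real \<delta> + real k - 3)
            \<longrightarrow> \<kappa> \<ge> k
              \<or> isomorphic_to_subgraph G (graph_join (complete_graph (k - 1))
                  (disjoint_union (complete_graph (\<delta> - k + 2)) (complete_graph (n - \<delta> - 1)))))"
proof -
  note G = assms(1)
  define X where "X = join_of_cliques (k - 1) (\<delta> - k + 2) (n - \<delta> - 1)"
  let ?p = "real \<delta> - real k + 2" and ?N = "real n - real \<delta> - 1"
  let ?ma = "real m \<ge> 1 / 2 * real n * (real n - 1) - ?p * ?N"
  let ?nb = "real n \<ge> 1 / 2 * (real k + 1) * ?p + (real \<delta> + 2)"
  let ?mb = "real m \<ge> 1 / 2 * real n * (real n - 1) - 1 / 2 * ?p * (2 * real n - 2 * real \<delta> + real k - 3)"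
  have "(?ma \<longrightarrow> isomorphic G X) \<and> (?nb \<and> ?mb \<longrightarrow> isomorphic_to_subgraph G X)" if "\<kappa> < k"
  proof -
    have "pverts G \<noteq> {}"
      using assms(3,4) by auto
    \<comment> \<open>If \<open>G\<close> were complete, then \<kappa> = n - 1 = \<delta> \<ge>
      k.\<close>
    then have "\<not> complete_digraph (card (pverts G)) (with_proj G)"
      using min_degree_complete[of G] that assms(6-8) by (auto simp: vertex_connectivity_def)
    then obtain S A B where sep: "separation G S A B" and S: "card S = \<kappa>"
      using vertex_connectivity_separation[OF G] assms(7) by metis
    define a b where "a = card A" and "b = card B"
    note fin = separation_card[OF G sep]
    have n: "n = \<kappa> + a + b"
      using fin(1) S assms(3) by (simp add: a_def b_def)
    have a: "\<delta> < a + \<kappa>" and b: "\<delta> < b + \<kappa>"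
      using separation_min_degree_less[OF G] sep separation_swap[OF G sep] S assms(6)
      by (auto simp: a_def b_def)
    have ch: "real (n choose 2) = 1 / 2 * real n * (real n - 1)"
      using assms(4) by (simp add: choose_two real_of_nat_div of_nat_diff)
    have edges: "real m + real a * real b \<le> 1 / 2 * real n * (real n - 1)"
      using separation_edges(1)[OF G sep] assms(3,5)
      unfolding ch[symmetric] a_def b_def by (metis of_nat_add of_nat_le_iff of_nat_mult)
    have sat: "saturated G A B" if "real m + real a * real b = 1 / 2 * real n * (real n - 1)"
      using that separation_edges(2)[OF G sep] assms(3,5)
      unfolding ch[symmetric] a_def b_def by (metis of_nat_add of_nat_eq_iff of_nat_mult)
    define q where "q = real \<delta> + 1 - real \<kappa>"
    \<comment> \<open>Here \<open>q - ?p\<close> equals k - 1 - \<kappa>, a nonnegative integer,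
      hence the gap of 1. Positivity of \<open>?N\<close> follows from n = \<kappa> + a + b,
      \<kappa> + a \<ge> \<delta> + 1 and b > 0.\<close>
    have aq: "real a \<ge> q" and bq: "real b \<ge> q" and qp: "q = ?p \<or> q \<ge> ?p + 1" and N: "?N > 0"
      and abq: "real a + real b = q + ?N"
    proof -
      have "real \<delta> + 1 \<le> real a + real \<kappa>" "real \<delta> + 1 \<le> real b + real \<kappa>"
        using a b by linarith+
      moreover have "real n = real \<kappa> + real a + real b"
        using n by simp
      moreover have "b > 0"
        using sep fin(4) by (auto simp: b_def separation_def card_gt_0_iff)
      then have "real b > 0"
        by simp
      moreover have "real \<kappa> + 1 = real k \<or> real \<kappa> + 2 \<le> real k"
        using that by (cases "k = \<kappa> + 1") auto
      ultimately show "real a \<ge> q" "real b \<ge> q" "q = ?p \<or> q \<ge> ?p + 1" "?N > 0"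
        "real a + real b = q + ?N"
        unfolding q_def by linarith+
    qed
    \<comment> \<open>\<open>q = ?p\<close> means \<kappa> = k - 1; once one side has \<delta> - k +
      2 vertices, n - \<delta> - 1 remain for the other.\<close>
    have X: "X = join_of_cliques (card S) (card A) (card B)" if "q = ?p" "real a = ?p"
    proof -
      have "k - 1 = \<kappa>" "\<delta> - k + 2 = a" "n - \<delta> - 1 = b"
        using that n assms(8) \<open>\<kappa> < k\<close> unfolding q_def by linarith+
      then show ?thesis by (simp add: X_def S a_def b_def)
    qed
    have X': "X = join_of_cliques (card S) (card B) (card A)" if "q = ?p" "real b = ?p"
    proof -
      have "k - 1 = \<kappa>" "\<delta> - k + 2 = b" "n - \<delta> - 1 = a"
        using that n assms(8) \<open>\<kappa> < k\<close> unfolding q_def by linarith+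
      then show ?thesis by (simp add: X_def S a_def b_def)
    qed
    have "isomorphic G X" if ?ma
    proof -
      have "real a * real b \<le> ?p * ?N"
        using that edges by linarith
      note * = part_sizes_few_missing[OF aq bq _ N abq this]
      have "q = ?p" "real a = ?p \<or> real b = ?p" "real a * real b = ?p * ?N"
        using * qp by auto
      \<comment> \<open>With this value of \<open>a * b\<close>, the assumed lower bound on
        \<open>m\<close> meets the upper bound \<open>edges\<close>.\<close>
      moreover have "saturated G A B"
        using sat that edges calculation(3) by linarith
      ultimately show ?thesis
        using X X' saturated_isomorphic[OF G] sep separation_swap[OF G sep] saturated_swap by metis
    qed
    moreover have "isomorphic_to_subgraph G X" if ?nb ?mb
    proof -
      \<comment> \<open>In terms of \<open>?N\<close>, the factor 2n - 2\<delta> + k - 3 is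
        \<open>2 * ?N + real k - 1\<close>.\<close>
      have mb: "real m \<ge> 1 / 2 * real n * (real n - 1) - 1 / 2 * (?p * (2 * ?N + real k - 1))"
        using that(2) by (simp add: algebra_simps)
      then have "2 * (real a * real b) \<le> ?p * (2 * ?N + real k - 1)"
        using edges by linarith
      moreover have "2 * (?N - 1) \<ge> (real k + 1) * ?p"
        using that(1) by (simp add: field_simps)
      moreover have "?p \<ge> 0"
        using assms(8) by simp
      ultimately have q: "q = ?p"
        and big: "real a \<ge> ?p + 1 \<Longrightarrow> real b \<ge> ?p + 1 \<Longrightarrow> 2 * (real a * real b) = ?p * (2 * ?N + real k - 1)"
        using part_sizes_more_missing[OF aq bq qp _ _ abq, of "real k"] by auto
      \<comment> \<open>If neither side had the minimal size, the edge count would be tight and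
        \<open>G\<close> saturated, so a vertex of minimum degree would force a side that is too
        small.\<close>
      have "real a = ?p \<or> real b = ?p"
      proof (rule ccontr)
        assume "\<not> (real a = ?p \<or> real b = ?p)"
        moreover have p: "?p = real (\<delta> - k + 2)"
          using assms(8) by (simp add: of_nat_diff)
        \<comment> \<open>Passing to natural numbers turns the strict inequalities into gaps of at
          least 1.\<close>
        ultimately have "a \<ge> \<delta> - k + 2 + 1" "b \<ge> \<delta> - k + 2 + 1"
          using aq bq unfolding q p by linarith+
        then have a: "real a \<ge> ?p + 1" and b: "real b \<ge> ?p + 1"
          unfolding p by linarith+
        with big have "2 * (real a * real b) = ?p * (2 * ?N + real k - 1)"
          by simp
        then have "saturated G A B"
          using sat edges mb by linarith
        then have "min a b + \<kappa> \<le> \<delta> + 1"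
          using saturated_min_degree[OF G sep] S assms(6) by (simp add: a_def b_def)
        \<comment> \<open>The smaller side would have at most \<delta> + 1 - \<kappa> =
          \<open>q\<close> = \<open>?p\<close> vertices.\<close>
        then show False
          using a b q unfolding q_def by (simp add: min_def split: if_splits)
      qed
      then show ?thesis
        using X X' q separation_isomorphic_to_subgraph[OF G] sep separation_swap[OF G sep] by metis
    qed
    ultimately show ?thesis
      by blast
  qed
  then show ?thesis
    unfolding X_def by (meson not_le)
qed

end
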